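(* If $G$ is a $C_{4k}$-free bipartite graph, then $\operatorname{null}(G)=|V(G)|-2\nu(G)$.
   Context: All graphs are finite, simple and undirected. A graph is a $C_{4k}$-free bipartite graph if it is bipartite and contains no cycle whose length is a multiple of $4$. $\operatorname{null}(G)$ is the dimension of the null space of the adjacency matrix of $G$, and $\nu(G)$ is the matching number of $G$ (the size of a maximum matching). *)

theory Defs
  imports "Graph_Theory.Arc_Walk" "Jordan_Normal_Form.Matrix_Kernel"
begin

text \<open>
  A finite simple undirected graph is an instance of the locale \<^locale>\<open>graph\<close>: a finite
  symmetric digraph without loops and parallel arcs, where an undirected edge between two
  vertices is represented by the two arcs joining them in opposite directions.
\<close>

definition undirected_edges :: "('a, 'b) pre_digraph \<Rightarrow> 'a set set" where
  "undirected_edges G = {{u, v} | u v. (u, v) \<in> arcs_ends G}"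

definition bipartite :: "('a, 'b) pre_digraph \<Rightarrow> bool" where
  "bipartite G \<longleftrightarrow> (\<exists>X Y. X \<union> Y = verts G \<and> X \<inter> Y = {} \<and>
     (\<forall>(u, v) \<in> arcs_ends G. (u \<in> X \<and> v \<in> Y) \<or> (u \<in> Y \<and> v \<in> X)))"

text \<open>
  A cycle of the digraph may go back and forth along one undirected edge. The
  bound on the length excludes exactly these cycles of length 2 in a loop-free graph.
\<close>

definition undirected_cycle :: "('a, 'b) pre_digraph \<Rightarrow> 'b list \<Rightarrow> bool" where
  "undirected_cycle G p \<longleftrightarrow> pre_digraph.cycle G p \<and> length p \<ge> 3"

definition C4k_free :: "('a, 'b) pre_digraph \<Rightarrow> bool" where
  "C4k_free G \<longleftrightarrow> \<not> (\<exists>p. undirected_cycle G p \<and> 4 dvd length p)"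

definition is_matching :: "('a, 'b) pre_digraph \<Rightarrow> 'a set set \<Rightarrow> bool" where
  "is_matching G M \<longleftrightarrow> M \<subseteq> undirected_edges G \<and> pairwise disjnt M"

definition matching_number :: "('a, 'b) pre_digraph \<Rightarrow> nat" where
  "matching_number G = Max (card ` {M. is_matching G M})"

text \<open>
  The rows and columns are indexed by the positions in the list \<open>vs\<close>, which is meant to
  enumerate the vertices of \<open>G\<close> without repetition.
\<close>

definition adjacency_matrix :: "('a, 'b) pre_digraph \<Rightarrow> 'a list \<Rightarrow> real mat" where
  "adjacency_matrix G vs = mat (length vs) (length vs)
     (\<lambda>(i, j). if (vs ! i, vs ! j) \<in> arcs_ends G then 1 else 0)"

definition nullity :: "('a, 'b) pre_digraph \<Rightarrow> 'a list \<Rightarrow> nat" where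
  "nullity G vs = kernel_dim (adjacency_matrix G vs)"

end

theory Submission
  imports Defs
begin

text \<open>
  The rank of the adjacency matrix is twice the matching number. It is at most that number in
  every bipartite graph: a matrix of rank \<open>r\<close> has \<open>r\<close> nonzero entries in distinct rows and distinct
  columns, and those whose column lies in a fixed colour class form a matching. Conversely, a
  kernel vector that vanishes off a matching is zero, since otherwise alternating between mates
  and neighbours of opposite sign closes up to a cycle of length divisible by 4.
\<close>

section \<open>Rank and kernel dimension by Gauss-Jordan elimination\<close>

text \<open>Both rank bounds read off the same data: \<open>I\<close> is the set of nonzero rows of
  the echelon form \<open>E\<close>, and \<open>f\<close> sends such a row to its pivot column.
  Pivot columns are unit vectors, so \<open>f\<close> is injective, and the number of pivots is
  \<open>n\<close> minus the kernel dimension.\<close>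

lemma gauss_jordan_pivots:
  fixes A :: "'k :: field mat"
  assumes A: "A \<in> carrier_mat n n"
  obtains E P Q I f where
    "E \<in> carrier_mat n n" "P \<in> carrier_mat n n" "Q \<in> carrier_mat n n"
    "E = P * A" "A = Q * E" "Q * P = 1\<^sub>m n"
    "I \<subseteq> {..<n}" "kernel_dim A + card I = n" "inj_on f I" "f ` I \<subseteq> {..<n}"
    "\<And>i i'. i \<in> I \<Longrightarrow> i' < n \<Longrightarrow> E $$ (i', f i) = (if i' = i then 1 else 0)"
    "\<And>i j. i < n \<Longrightarrow> i \<notin> I \<Longrightarrow> j < n \<Longrightarrow> E $$ (i, j) = 0"
proof -
  define E where "E = gauss_jordan_single A"
  note gj = gauss_jordan_single[OF A E_def[symmetric]]
  from gj(4) obtain P Q where PQ: "E = P * A" "P \<in> carrier_mat n n" "Q \<in> carrier_mat n n"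
    "Q * P = 1\<^sub>m n" by blast
  have E: "E \<in> carrier_mat n n" by (rule gj(2))
  from gj(3) E obtain f where f: "pivot_fun E f n" unfolding row_echelon_form_def by auto
  have "dim_row E = n" using E by auto
  note piv = pivot_funD[OF this f]
  define I where "I = {i. i < n \<and> f i \<noteq> n}"
  have QE: "A = Q * E"
    using PQ A assoc_mult_mat[of Q n n P n A n] by simp
  have flt: "f i < n" if "i \<in> I" for i
    using that piv(1)[of i] by (auto simp: I_def)
  have col: "E $$ (i', f i) = (if i' = i then 1 else 0)" if "i \<in> I" "i' < n" for i i'
    using that piv(4)[of i] piv(5)[of i i'] flt[of i] by (auto simp: I_def)
  have inj: "inj_on f I"
  proof (rule inj_onI)
    fix i i' assume "i \<in> I" "i' \<in> I" "f i = f i'"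
    then show "i = i'"
      using col[of i i] col[of i' i] by (auto simp: I_def split: if_splits)
  qed
  have "{i. i < n \<and> row E i \<noteq> 0\<^sub>v n} = I"
    using pivot_fun_zero_row_iff[OF f E] by (auto simp: I_def)
  then have len: "length (pivot_positions E) = card I"
    using pivot_positions(4)[OF E f] by simp
  \<comment> \<open>The dimension formula subtracts natural numbers; this bound turns it into an
    equation between sums.\<close>
  have "card I \<le> n"
    using card_mono[of "{..<n}" I] by (auto simp: I_def)
  then have "kernel_dim A + card I = n"
    using kernel_dim_code[of A] A len unfolding E_def by simp
  moreover have "E $$ (i, j) = 0" if "i < n" "i \<notin> I" "j < n" for i j
    using that piv(2)[of i j] by (auto simp: I_def)
  ultimately show ?thesis
    using that[OF E PQ(2,3,1) QE PQ(4) _ _ inj _ col] flt by (auto simp: I_def)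
qed

text \<open>A pivot column of \<open>A\<close> is a column of the invertible matrix \<open>Q\<close> with \<open>A = Q * E\<close>, and
  the Leibniz formula for \<open>det Q\<close> has a nonzero term.\<close>

lemma nonzero_transversal_of_rank_size:
  fixes A :: "'k :: field mat"
  assumes A: "A \<in> carrier_mat n n"
  obtains I :: "nat set" and f g where
    "finite I" "kernel_dim A + card I = n" "inj_on f I" "inj_on g I"
    "f ` I \<subseteq> {..<n}" "g ` I \<subseteq> {..<n}" "\<forall>i\<in>I. A $$ (g i, f i) \<noteq> 0"
proof -
  obtain E P Q I f where *:
    "E \<in> carrier_mat n n" "P \<in> carrier_mat n n" "Q \<in> carrier_mat n n"
    "E = P * A" "A = Q * E" "Q * P = 1\<^sub>m n"
    "I \<subseteq> {..<n}" "kernel_dim A + card I = n" "inj_on f I" "f ` I \<subseteq> {..<n}"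
    "\<And>i i'. i \<in> I \<Longrightarrow> i' < n \<Longrightarrow> E $$ (i', f i) = (if i' = i then 1 else 0)"
    "\<And>i j. i < n \<Longrightarrow> i \<notin> I \<Longrightarrow> j < n \<Longrightarrow> E $$ (i, j) = 0"
    by (rule gauss_jordan_pivots[OF A]) metis
  have "det Q * det P = 1" using det_mult[OF *(3,2)] *(6) by simp
  then have "det Q \<noteq> 0" by auto
  then obtain p where p: "p permutes {0..<n}" and "(\<Prod>i = 0..<n. Q $$ (i, p i)) \<noteq> 0"
    unfolding det_def'[OF *(3)] by (metis (no_types, lifting) mem_Collect_eq mult_zero_right sum.neutral)
  then have Q: "Q $$ (i, p i) \<noteq> 0" if "i < n" for i
    using that by auto
  \<comment> \<open>Column \<open>f i\<close> of \<open>A\<close> is column \<open>i\<close> of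
    \<open>Q\<close>, and the chosen Leibniz term meets that column in the row that \<open>p\<close>
    sends to \<open>i\<close>.\<close>
  define g where "g = inv_into UNIV p"
  have gperm: "g permutes {0..<n}" unfolding g_def by (rule permutes_inv[OF p])
  have glt: "g i < n" if "i < n" for i
    using permutes_in_image[OF gperm, of i] that by simp
  have "A $$ (g i, f i) \<noteq> 0" if i: "i \<in> I" for i
  proof -
    have lt: "i < n" "f i < n" "g i < n" using i *(7,10) glt by auto
    have "A $$ (g i, f i) = (\<Sum>l = 0..<n. Q $$ (g i, l) * E $$ (l, f i))"
      using lt *(1,3) by (subst *(5)) (auto simp: scalar_prod_def)
    also have "\<dots> = (\<Sum>l = 0..<n. if l = i then Q $$ (g i, l) else 0)"
      using *(11)[OF i] by (intro sum.cong) auto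
    also have "\<dots> = Q $$ (g i, i)" using lt by simp
    also have "i = p (g i)" unfolding g_def using permutes_inverses(1)[OF p] by simp
    finally show ?thesis using Q[OF lt(3)] \<open>i = p (g i)\<close> by simp
  qed
  moreover have "inj_on g I"
    using permutes_inj[OF gperm] by (rule inj_on_subset) simp
  moreover have "finite I" using *(7) finite_subset by blast
  moreover have "g ` I \<subseteq> {..<n}" using *(7) glt by auto
  ultimately show ?thesis
    using that[of I f g] *(8,9,10) by simp
qed

text \<open>If \<open>S\<close> had more elements than \<open>A\<close> has pivots, the pivot rows of the echelon form together
  with the unit vectors outside \<open>S\<close> would be fewer than \<open>n\<close> linear equations.\<close>

lemma kernel_dim_supported:
  fixes A :: "'k :: field mat"
  assumes A: "A \<in> carrier_mat n n" and S: "S \<subseteq> {..<n}"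
    and triv: "\<And>v. v \<in> carrier_vec n \<Longrightarrow> A *\<^sub>v v = 0\<^sub>v n \<Longrightarrow>
      (\<And>j. j < n \<Longrightarrow> j \<notin> S \<Longrightarrow> v $ j = 0) \<Longrightarrow> v = 0\<^sub>v n"
  shows "kernel_dim A + card S \<le> n"
proof (rule ccontr)
  obtain E P Q I f where *:
    "E \<in> carrier_mat n n" "P \<in> carrier_mat n n" "Q \<in> carrier_mat n n"
    "E = P * A" "A = Q * E" "Q * P = 1\<^sub>m n"
    "I \<subseteq> {..<n}" "kernel_dim A + card I = n" "inj_on f I" "f ` I \<subseteq> {..<n}"
    "\<And>i i'. i \<in> I \<Longrightarrow> i' < n \<Longrightarrow> E $$ (i', f i) = (if i' = i then 1 else 0)"
    "\<And>i j. i < n \<Longrightarrow> i \<notin> I \<Longrightarrow> j < n \<Longrightarrow> E $$ (i, j) = 0"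
    by (rule gauss_jordan_pivots[OF A]) metis
  assume "\<not> ?thesis"
  then have "card I < card S" using *(8) by linarith
  moreover have fin: "finite I" "finite S" using *(7) S finite_subset by blast+
  moreover have "card S \<le> n" using card_mono[OF _ S] by simp
  ultimately have "card ({..<n} - S) < card ({..<n} - I)"
    using *(7) S by (simp add: card_Diff_subset)
  \<comment> \<open>\<open>h\<close> places the equation \<open>v $ j = 0\<close>, for each
    \<open>j\<close> outside \<open>S\<close>, in a row without pivot. There are fewer such
    equations than such rows, so some row \<open>i0\<close> stays free.\<close>
  then obtain h where h: "h ` ({..<n} - S) \<subseteq> {..<n} - I" "inj_on h ({..<n} - S)"
    and "h ` ({..<n} - S) \<noteq> {..<n} - I"
    by (metis card_image card_le_inj finite_Diff finite_lessThan less_imp_le less_irrefl)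
  then obtain i0 where i0: "i0 < n" "i0 \<notin> I" "i0 \<notin> h ` ({..<n} - S)" by auto
  define c where "c i = vec n (\<lambda>j. if i \<in> I then E $$ (i, j)
      else if j \<notin> S \<and> h j = i then 1 else 0)" for i
  \<comment> \<open>\<open>D\<close> collects all the equations; its free row \<open>i0\<close> is
    zero, so it is singular and the equations have a nonzero common solution.\<close>
  define D where "D = mat\<^sub>r n n (\<lambda>i. if i = i0 then 0\<^sub>v n else c i)"
  have D: "D \<in> carrier_mat n n" unfolding D_def by simp
  have "det D = 0"
    unfolding D_def by (rule det_row_0[OF i0(1)]) (simp add: c_def)
  then obtain v where v: "v \<in> carrier_vec n" "v \<noteq> 0\<^sub>v n" "D *\<^sub>v v = 0\<^sub>v n"
    using det_0_iff_vec_prod_zero_field[OF D] by blast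
  have cv: "c i \<bullet> v = 0" if "i < n" "i \<noteq> i0" for i
  proof -
    have "(D *\<^sub>v v) $ i = c i \<bullet> v" using that unfolding D_def by (simp add: c_def)
    then show ?thesis using v(3) that by simp
  qed
  have "v $ j = 0" if j: "j < n" "j \<notin> S" for j
  proof -
    have hj: "h j < n" "h j \<notin> I" "h j \<noteq> i0" using h(1) i0 j by auto
    have "c (h j) \<bullet> v = (\<Sum>l = 0..<n. if l = j then v $ l else 0)"
      unfolding scalar_prod_def c_def using v(1) hj j inj_onD[OF h(2)]
      by (intro sum.cong) auto
    also have "\<dots> = v $ j" using j by simp
    finally show ?thesis using cv[OF hj(1,3)] by simp
  qed
  moreover have "E *\<^sub>v v = 0\<^sub>v n"
  proof (rule eq_vecI)
    fix i assume "i < dim_vec (0\<^sub>v n :: 'k vec)"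
    then have i: "i < n" by simp
    have "row E i \<bullet> v = 0"
    proof (cases "i \<in> I")
      case True
      then have "row E i = c i" using *(1) i by (intro eq_vecI) (auto simp: c_def)
      then show ?thesis using cv[of i] True i i0 by auto
    next
      case False
      then have "row E i = 0\<^sub>v n" using *(1,12) i by (intro eq_vecI) auto
      then show ?thesis using v(1) by simp
    qed
    then show "(E *\<^sub>v v) $ i = 0\<^sub>v n $ i" using *(1) i by simp
  qed (use *(1) in auto)
  then have "A *\<^sub>v v = 0\<^sub>v n"
    using *(1,3,5) v(1) assoc_mult_mat_vec[of Q n n E n v] by (auto intro!: eq_vecI)
  ultimately show False using triv v by blast
qed

section \<open>Closed vertex sequences, cycles and first returns\<close>

text \<open>A \<open>cycle\<close> is a list of arcs, so an arc is chosen for each pair of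
  consecutive vertices. Its distinctness condition concerns the heads \<open>w 1\<close>, ...,
  \<open>w n\<close>, a cyclic shift of the injective window.\<close>

lemma (in wf_digraph) closed_vertex_sequence_cycle:
  fixes w :: "nat \<Rightarrow> 'a"
  assumes adj: "\<And>i. i < n \<Longrightarrow> w i \<rightarrow> w (Suc i)"
    and closed: "w n = w 0" and inj: "inj_on w {..<n}" and n: "0 < n"
  obtains p where "cycle p" "length p = n"
proof -
  have "\<exists>e. e \<in> arcs G \<and> tail G e = w i \<and> head G e = w (Suc i)" if "i < n" for i
    using reachableE[OF adj[OF that]] by blast
  then obtain e where e: "\<And>i. i < n \<Longrightarrow> e i \<in> arcs G"
    "\<And>i. i < n \<Longrightarrow> tail G (e i) = w i" "\<And>i. i < n \<Longrightarrow> head G (e i) = w (Suc i)"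
    by metis
  have cas: "cas (w i) (map e [i..<j]) (w j)" if "i \<le> j" "j \<le> n" for i j
    using that
  proof (induction rule: inc_induct)
    case (step i)
    then show ?case using e by (simp add: upt_conv_Cons)
  qed simp
  define p where "p = map e [0..<n]"
  have ne: "p \<noteq> []" using n by (simp add: p_def)
  have walk: "awalk (w 0) p (w 0)"
    unfolding awalk_def using e n cas[of 0 n] closed tail_in_verts[OF e(1)[OF n]]
    by (auto simp: p_def)
  have "tl (awalk_verts (w 0) p) = map (head G) p"
    using awalk_verts_conv'[of "w 0" p "w 0"] walk ne by (auto simp: awalk_def)
  also have "\<dots> = map w (map Suc [0..<n])" using e by (simp add: p_def)
  finally have vs: "tl (awalk_verts (w 0) p) = map w [Suc 0..<Suc n]"
    by (simp only: map_Suc_upt)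
  have "inj_on w {Suc 0..<Suc n}"
  proof (rule inj_onI)
    fix i j assume ij: "i \<in> {Suc 0..<Suc n}" "j \<in> {Suc 0..<Suc n}" "w i = w j"
    \<comment> \<open>\<open>r\<close> moves the last index \<open>n\<close> to \<open>0\<close>,
      where \<open>w\<close> has the same value, so injectivity on \<open>{..<n}\<close> covers the
      shifted window.\<close>
    define r where "r k = (if k = n then 0 else k)" for k
    have "w (r i) = w (r j)" "r i < n" "r j < n"
      using ij closed n by (auto simp: r_def)
    then have "r i = r j" using inj by (simp add: inj_on_eq_iff)
    then show "i = j" using ij by (auto simp: r_def split: if_splits)
  qed
  then have "distinct (tl (awalk_verts (w 0) p))"
    unfolding vs distinct_map set_upt by (rule conjI[OF distinct_upt])
  then have "cycle p" using walk ne unfolding cycle_def by blast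
  then show ?thesis using that by (simp add: p_def)
qed

text \<open>A finite range forces a repetition. Taking the least gap \<open>d\<close> over all
  starting points at once makes the window from \<open>a\<close> on injective, since a repetition
  inside it would have a smaller gap. The offset \<open>a\<close> is there because the sequence need
  not return to its first value.\<close>

lemma minimal_period:
  fixes y :: "nat \<Rightarrow> 'a"
  assumes "finite (range y)"
  obtains a d where "0 < d" "y (a + d) = y a" "inj_on (\<lambda>i. y (a + i)) {..<d}"
proof -
  define R where "R d \<longleftrightarrow> 0 < d \<and> (\<exists>a. y (a + d) = y a)" for d
  have "\<not> inj y" using assms finite_imageD[of y UNIV] infinite_UNIV_nat by blast
  then obtain i j where "i < j" "y i = y j" unfolding inj_def by (metis nat_neq_iff)
  then have "R (j - i)" unfolding R_def by (auto intro!: exI[of _ i])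
  define d where "d = (LEAST d. R d)"
  have "R d" unfolding d_def using \<open>R (j - i)\<close> by (rule LeastI)
  then obtain a where a: "0 < d" "y (a + d) = y a" by (auto simp: R_def)
  have less: False if "k < l" "l < d" "y (a + k) = y (a + l)" for k l
  proof -
    have "R (l - k)" unfolding R_def using that by (auto intro!: exI[of _ "a + k"])
    then have "d \<le> l - k" unfolding d_def by (rule Least_le)
    then show False using that by simp
  qed
  have "inj_on (\<lambda>i. y (a + i)) {..<d}"
  proof (rule inj_onI)
    fix k l assume "k \<in> {..<d}" "l \<in> {..<d}" "y (a + k) = y (a + l)"
    then show "k = l" using less[of k l] less[of l k] by (cases k l rule: linorder_cases) auto
  qed
  with a show ?thesis using that by blast
qed

section \<open>Matchings and the matching number\<close>

text \<open>The mate \<open>m v\<close> is the other end of the matching edge at \<open>v\<close>.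
  Two vertices with a common mate lie on edges that meet, hence on the same edge. Injectivity later
  keeps the mates on a closed walk distinct.\<close>

lemma (in graph) matching_mate:
  assumes M: "is_matching G M"
  obtains m where "\<And>v. v \<in> \<Union>M \<Longrightarrow> v \<rightarrow> m v" "\<And>v. v \<in> \<Union>M \<Longrightarrow> m v \<in> \<Union>M"
    "inj_on m (\<Union>M)"
proof -
  have sym: "(v, u) \<in> arcs_ends G" if "(u, v) \<in> arcs_ends G" for u v
    using arcs_ends_symmetric[OF sym_arcs that] .
  have "\<exists>u. v \<rightarrow> u \<and> {v, u} \<in> M" if "v \<in> \<Union>M" for v
  proof -
    from that obtain e where e: "e \<in> M" "v \<in> e" by blast
    then have "e \<in> undirected_edges G" using M by (auto simp: is_matching_def)
    then obtain a b where ab: "e = {a, b}" "a \<rightarrow> b" by (auto simp: undirected_edges_def)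
    show ?thesis
    proof (cases "v = a")
      case True then show ?thesis using ab e by auto
    next
      case False
      then have "v = b" using ab e by auto
      then show ?thesis using ab e sym by (intro exI[of _ a]) (auto simp: insert_commute)
    qed
  qed
  then obtain m where m: "\<And>v. v \<in> \<Union>M \<Longrightarrow> v \<rightarrow> m v" "\<And>v. v \<in> \<Union>M \<Longrightarrow> {v, m v} \<in> M"
    by metis
  have "inj_on m (\<Union>M)"
  proof (rule inj_onI)
    fix u v assume uv: "u \<in> \<Union>M" "v \<in> \<Union>M" "m u = m v"
    have "\<not> disjnt {u, m u} {v, m v}" using uv(3) by simp
    then have "{u, m u} = {v, m v}"
      using M m(2)[OF uv(1)] m(2)[OF uv(2)] pairwiseD unfolding is_matching_def by metis
    moreover have "u \<noteq> m u" "v \<noteq> m v"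
      using m(1) uv(1,2) adj_not_same by metis+
    ultimately show "u = v" using uv(3) by (auto simp: doubleton_eq_iff)
  qed
  then show ?thesis using that m by blast
qed

lemma (in graph) card_Union_matching:
  assumes M: "is_matching G M"
  shows "finite M" "\<Union>M \<subseteq> verts G" "card (\<Union>M) = 2 * card M"
proof -
  have edges: "M \<subseteq> undirected_edges G" "pairwise disjnt M"
    using M by (auto simp: is_matching_def)
  then show sub: "\<Union>M \<subseteq> verts G"
    by (force simp: undirected_edges_def dest: adj_in_verts)
  then show fin: "finite M"
    by (intro finite_subset[of M "Pow (verts G)"]) auto
  have two: "card e = 2" if "e \<in> M" for e
    using that edges(1) adj_not_same by (auto simp: undirected_edges_def card_2_iff) blast
  have "card (\<Union>M) = (\<Sum>e\<in>M. card e)"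
    using edges(2) two by (intro card_Union_disjoint) (auto intro: card_ge_0_finite)
  then show "card (\<Union>M) = 2 * card M" using two by simp
qed

text \<open>\<open>Max\<close> is meaningful here because matchings are families of subsets of the
  finite vertex set, and the empty family is one of them.\<close>

lemma (in graph) matching_number:
  shows "\<exists>M. is_matching G M \<and> card M = matching_number G"
    and "is_matching G M \<Longrightarrow> card M \<le> matching_number G"
proof -
  have "{M. is_matching G M} \<subseteq> Pow (Pow (verts G))"
    using card_Union_matching(2) by blast
  then have fin: "finite {M. is_matching G M}"
    by (rule finite_subset) simp
  have "is_matching G {}" by (simp add: is_matching_def)
  then have "{M. is_matching G M} \<noteq> {}" by blast
  with fin have "matching_number G \<in> card ` {M. is_matching G M}"
    unfolding matching_number_def by (intro Max_in) auto
  then show "\<exists>M. is_matching G M \<and> card M = matching_number G" by auto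
  show "is_matching G M \<Longrightarrow> card M \<le> matching_number G"
    unfolding matching_number_def using fin by (intro Max_ge) auto
qed

section \<open>Upper bound on the nullity: kernel vectors supported on a matching\<close>

lemma bipartite_colouring:
  fixes G :: "('a, 'b) pre_digraph"
  assumes "bipartite G"
  obtains X where "\<And>u v. (u, v) \<in> arcs_ends G \<Longrightarrow> u \<in> X \<longleftrightarrow> v \<notin> X"
proof -
  obtain X Y where XY: "X \<inter> Y = {}"
    "\<forall>(u, v) \<in> arcs_ends G. (u \<in> X \<and> v \<in> Y) \<or> (u \<in> Y \<and> v \<in> X)"
    using assms by (auto simp: bipartite_def)
  have "u \<in> X \<longleftrightarrow> v \<notin> X" if "(u, v) \<in> arcs_ends G" for u v
    using bspec[OF XY(2) that] XY(1) by auto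
  then show ?thesis using that by blast
qed

text \<open>From a vertex where the kernel vector is nonzero, walk to its mate and on to a neighbour of
  the mate with a value of the opposite sign. At the first return the signs force an even number
  of such double steps.\<close>

lemma (in graph) supported_on_matching_zero:
  fixes g :: "'a \<Rightarrow> real"
  assumes bip: "bipartite G" and free: "C4k_free G" and M: "is_matching G M"
    and kernel: "\<And>v. v \<in> verts G \<Longrightarrow> (\<Sum>w | v \<rightarrow> w. g w) = 0"
    and supp: "\<And>v. v \<in> verts G \<Longrightarrow> v \<notin> \<Union>M \<Longrightarrow> g v = 0"
    and v0: "v0 \<in> verts G"
  shows "g v0 = 0"
proof (rule ccontr)
  assume nz: "g v0 \<noteq> 0"
  note UM = card_Union_matching[OF M]
  obtain m where m: "\<And>v. v \<in> \<Union>M \<Longrightarrow> v \<rightarrow> m v" "\<And>v. v \<in> \<Union>M \<Longrightarrow> m v \<in> \<Union>M"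
    "inj_on m (\<Union>M)"
    using matching_mate[OF M] by blast
  obtain X where X: "\<And>u v. u \<rightarrow> v \<Longrightarrow> u \<in> X \<longleftrightarrow> v \<notin> X"
    using bipartite_colouring[OF bip] by blast
  define T where "T = {v \<in> \<Union>M. g v \<noteq> 0}"
  \<comment> \<open>Otherwise every term \<open>g w * g v\<close> over the neighbours
    \<open>w\<close> of \<open>m v\<close> is nonnegative, vertices outside \<open>T\<close>
    contributing zero, while \<open>w = v\<close> gives a positive term. This contradicts the kernel
    equation at \<open>m v\<close>.\<close>
  have "\<exists>u\<in>T. m v \<rightarrow> u \<and> g u * g v < 0" if v: "v \<in> T" for v
  proof (rule ccontr)
    assume no: "\<not> ?thesis"
    have mv: "m v \<in> verts G" "m v \<rightarrow> v"
      using v m(1,2) UM(2) arcs_ends_symmetric[OF sym_arcs] by (auto simp: T_def)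
    have fin: "finite {w. m v \<rightarrow> w}"
      by (rule finite_subset[of _ "verts G"]) (auto dest: adj_in_verts)
    have nonneg: "0 \<le> g w * g v" if "m v \<rightarrow> w" for w
      using no supp[of w] adj_in_verts(2)[OF that] that by (force simp: T_def not_less)
    have "0 < g v * g v" using v by (simp add: T_def zero_less_mult_iff linorder_neq_iff disj_commute)
    also have "\<dots> \<le> (\<Sum>w | m v \<rightarrow> w. g w * g v)"
      by (rule member_le_sum) (use mv fin nonneg in auto)
    also have "\<dots> = 0" using kernel[OF mv(1)] by (simp flip: sum_distrib_right)
    finally show False by simp
  qed
  then obtain s where s: "\<And>v. v \<in> T \<Longrightarrow> s v \<in> T" "\<And>v. v \<in> T \<Longrightarrow> m v \<rightarrow> s v"
    "\<And>v. v \<in> T \<Longrightarrow> g (s v) * g v < 0"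
    by metis
  define y where "y i = (s ^^ i) v0" for i
  have "v0 \<in> T" using nz supp v0 by (auto simp: T_def)
  then have yT: "y i \<in> T" for i by (induction i) (auto simp: y_def s)
  then have yM: "y i \<in> \<Union>M" for i by (auto simp: T_def)
  have ySuc: "y (Suc i) = s (y i)" for i by (simp add: y_def)
  have adj1: "y i \<rightarrow> m (y i)" for i using m(1) yM by blast
  have adj2: "m (y i) \<rightarrow> y (Suc i)" for i using s(2) yT by (simp add: ySuc)
  have side: "y i \<in> X \<longleftrightarrow> y 0 \<in> X" for i
    by (induction i) (use X adj1 adj2 in blast)+
  have sign: "0 < g (y (a + i)) * g (y a) \<longleftrightarrow> even i" for a i
  proof (induction i)
    case 0
    then show ?case using yT[of a] by (simp add: T_def zero_less_mult_iff linorder_neq_iff disj_commute)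
  next
    case (Suc i)
    have "g (y (a + Suc i)) * g (y (a + i)) < 0" using s(3)[OF yT] by (simp add: ySuc)
    moreover have "g (y a) \<noteq> 0" using yT by (simp add: T_def)
    ultimately show ?case using Suc
      by (auto simp: zero_less_mult_iff mult_less_0_iff)
  qed
  have "finite (range y)"
    by (rule finite_subset[of _ "verts G"]) (use yM UM(2) in auto)
  then obtain a d where d: "0 < d" "y (a + d) = y a" "inj_on (\<lambda>i. y (a + i)) {..<d}"
    by (rule minimal_period)
  have "even d" using sign[of a d] sign[of a 0] d(2) by simp
  \<comment> \<open>\<open>w\<close> unfolds the double steps: vertices of the walk at even
    positions, their mates at odd ones. One period of \<open>y\<close> thus has length
    \<open>2 * d\<close> in \<open>w\<close>.\<close>
  define w where "w j = (if even j then y (a + j div 2) else m (y (a + j div 2)))" for j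
  \<comment> \<open>Double steps keep the colour and single steps change it, so equal values of
    \<open>w\<close> occur only at positions of equal parity. Within one parity, injectivity of
    \<open>m\<close> and of the window of \<open>y\<close> decides.\<close>
  have wX: "w j \<in> X \<longleftrightarrow> (even j \<longleftrightarrow> y 0 \<in> X)" for j
    using side X adj1 unfolding w_def by metis
  have "w j \<rightarrow> w (Suc j)" for j
    using adj1 adj2 by (auto simp: w_def)
  moreover have "w (2 * d) = w 0" using d(2) by (simp add: w_def)
  moreover have "inj_on w {..<2 * d}"
  proof (rule inj_onI)
    fix j k assume jk: "j \<in> {..<2 * d}" "k \<in> {..<2 * d}" "w j = w k"
    then have par: "even j = even k" using wX by metis
    then have "y (a + j div 2) = y (a + k div 2)"
      using jk(3) m(3) yM by (auto simp: w_def inj_on_eq_iff split: if_splits)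
    moreover have "j div 2 < d" "k div 2 < d" using jk by auto
    ultimately have "j div 2 = k div 2" using d(3) by (auto dest: inj_onD)
    with par show "j = k" by (metis dvd_div_mult_self mult.commute odd_two_times_div_two_succ)
  qed
  ultimately obtain p where p: "cycle p" "length p = 2 * d"
    using closed_vertex_sequence_cycle[of "2 * d" w] d(1) by auto
  \<comment> \<open>The cycle has length \<open>4 * k\<close> with \<open>k\<close> positive, which
    also gives the lower bound \<open>3\<close> that rules out going back and forth along one
    edge.\<close>
  obtain k where "d = 2 * k" using \<open>even d\<close> by blast
  then have "undirected_cycle G p" "4 dvd length p"
    using p d(1) by (auto simp: undirected_cycle_def)
  then show False using free by (auto simp: C4k_free_def)
qed

text \<open>The indices of the matched vertices form a set \<open>S\<close> of size
  \<open>2 * card M\<close>. A kernel vector supported on \<open>S\<close>, read as a function on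
  vertices, vanishes off the matching and is therefore zero, so \<open>kernel_dim_supported\<close>
  applies.\<close>

lemma (in graph) nullity_le:
  assumes "bipartite G" "C4k_free G" and M: "is_matching G M"
    and vs: "distinct vs" "set vs = verts G"
  shows "nullity G vs + 2 * card M \<le> card (verts G)"
proof -
  define n where "n = length vs"
  define A where "A = adjacency_matrix G vs"
  have bij: "bij_betw ((!) vs) {..<n} (verts G)"
    using bij_betw_nth[OF vs(1), of "{..<n}" "verts G"] vs(2) by (simp add: n_def)
  have idx: "\<exists>i<n. u = vs ! i" if "u \<in> verts G" for u
    using that vs(2) by (metis in_set_conv_nth n_def)
  define S where "S = {i. i < n \<and> vs ! i \<in> \<Union>M}"
  have img: "(!) vs ` S = \<Union>M"
  proof
    show "\<Union>M \<subseteq> (!) vs ` S"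
    proof
      fix u assume u: "u \<in> \<Union>M"
      then have "u \<in> set vs" using card_Union_matching(2)[OF M] vs(2) by blast
      then show "u \<in> (!) vs ` S" using u by (auto simp: S_def n_def in_set_conv_nth)
    qed
  qed (auto simp: S_def)
  have "inj_on ((!) vs) S"
    using bij by (auto simp: bij_betw_def S_def intro: inj_on_subset)
  then have "card S = card (\<Union>M)" using card_image img by metis
  then have cardS: "card S = 2 * card M" using card_Union_matching(3)[OF M] by simp
  have A: "A \<in> carrier_mat n n" by (simp add: A_def adjacency_matrix_def n_def)
  have "kernel_dim A + card S \<le> n"
  proof (rule kernel_dim_supported[OF A])
    show "S \<subseteq> {..<n}" by (auto simp: S_def)
    fix v :: "real vec"
    assume v: "v \<in> carrier_vec n" "A *\<^sub>v v = 0\<^sub>v n" "\<And>j. j < n \<Longrightarrow> j \<notin> S \<Longrightarrow> v $ j = 0"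
    \<comment> \<open>Off \<open>verts G\<close> the value of \<open>g\<close> is arbitrary; the
      sums below range over neighbours only, which are vertices.\<close>
    define g where "g u = v $ inv_into {..<n} ((!) vs) u" for u
    have g: "g (vs ! j) = v $ j" if "j < n" for j
      using that bij by (simp add: g_def bij_betw_def)
    have "(\<Sum>w | u \<rightarrow> w. g w) = 0" if u: "u \<in> verts G" for u
    proof -
      obtain i where i: "i < n" "u = vs ! i" using idx[OF u] by blast
      have "(\<Sum>w | u \<rightarrow> w. g w) = (\<Sum>w\<in>verts G. if u \<rightarrow> w then g w else 0)"
        by (subst sum.inter_filter[symmetric]) (auto intro!: sum.cong dest: adj_in_verts)
      also have "\<dots> = (\<Sum>j<n. if u \<rightarrow> vs ! j then g (vs ! j) else 0)"
        by (rule sum.reindex_bij_betw[OF bij, symmetric])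
      also have "\<dots> = (\<Sum>j = 0..<n. A $$ (i, j) * v $ j)"
      proof (rule sum.cong)
        fix j assume "j \<in> {0..<n}"
        then have j: "j < n" by simp
        then have "A $$ (i, j) = (if u \<rightarrow> vs ! j then 1 else 0)"
          using i by (simp add: A_def adjacency_matrix_def n_def)
        then show "(if u \<rightarrow> vs ! j then g (vs ! j) else 0) = A $$ (i, j) * v $ j"
          using g[OF j] by simp
      qed auto
      also have "\<dots> = (A *\<^sub>v v) $ i"
        using A v(1) i by (auto simp: scalar_prod_def)
      finally show ?thesis using v(2) i by simp
    qed
    moreover have "g u = 0" if u: "u \<in> verts G" "u \<notin> \<Union>M" for u
    proof -
      obtain i where i: "i < n" "u = vs ! i"
        using idx[OF u(1)] by blast
      then show ?thesis using u v(3) g by (simp add: S_def)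
    qed
    ultimately have "g u = 0" if "u \<in> verts G" for u
      using supported_on_matching_zero[OF assms(1,2) M] that by blast
    then have "v $ j = 0" if "j < n" for j
      using g[OF that] that vs(2) by (metis n_def nth_mem)
    then show "v = 0\<^sub>v n" using v(1) by (intro eq_vecI) auto
  qed
  then show ?thesis
    using cardS distinct_card[OF vs(1)] vs(2) by (simp add: nullity_def A_def n_def)
qed

section \<open>Lower bound on the nullity: matchings from a transversal\<close>

text \<open>When all \<open>f i\<close> lie on one side of the colouring, all \<open>g i\<close> lie
  on the other, so no \<open>f i\<close> equals any \<open>g j\<close>. As both maps are injective,
  the edges \<open>{f i, g i}\<close> are pairwise disjoint.\<close>

lemma (in graph) card_le_matching_number:
  assumes X: "\<And>u v. u \<rightarrow> v \<Longrightarrow> u \<in> X \<longleftrightarrow> v \<notin> X"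
    and inj: "inj_on f I" "inj_on g I"
    and adj: "\<And>i. i \<in> I \<Longrightarrow> f i \<rightarrow> g i" and side: "f ` I \<subseteq> X \<or> f ` I \<inter> X = {}"
  shows "card I \<le> matching_number G"
proof -
  define e where "e i = {f i, g i}" for i
  have ne: "f i \<noteq> g j" if "i \<in> I" "j \<in> I" for i j
  proof -
    have "f i \<in> X \<longleftrightarrow> f j \<in> X" using side that by auto
    then show ?thesis using X[OF adj[OF that(2)]] by metis
  qed
  have disj: "e i \<inter> e j = {}" if "i \<in> I" "j \<in> I" "i \<noteq> j" for i j
    using that inj ne by (auto simp: e_def inj_on_eq_iff dest: not_sym)
  have "inj_on e I"
  proof (rule inj_onI)
    fix i j assume "i \<in> I" "j \<in> I" "e i = e j"
    then show "i = j" using disj[of i j] by (auto simp: e_def)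
  qed
  then have "card (e ` I) = card I" by (rule card_image)
  moreover have "is_matching G (e ` I)"
    unfolding is_matching_def pairwise_def disjnt_def undirected_edges_def
    using adj disj by (auto simp: e_def)
  ultimately show ?thesis using matching_number(2) by metis
qed

text \<open>The nonzero transversal gives as many arcs as the rank, with distinct tails and distinct
  heads. A vertex may still be both a tail and a head; splitting \<open>I\<close> by the colour of
  the tail \<open>a i\<close> yields two matchings, so the rank is at most twice the matching
  number.\<close>

lemma (in graph) le_nullity:
  assumes bip: "bipartite G" and vs: "distinct vs" "set vs = verts G"
  shows "card (verts G) \<le> nullity G vs + 2 * matching_number G"
proof -
  define n where "n = length vs"
  define A where "A = adjacency_matrix G vs"
  have A: "A \<in> carrier_mat n n" by (simp add: A_def adjacency_matrix_def n_def)
  obtain X where X: "\<And>u v. u \<rightarrow> v \<Longrightarrow> u \<in> X \<longleftrightarrow> v \<notin> X"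
    using bipartite_colouring[OF bip] by blast
  obtain I :: "nat set" and f g where I:
    "finite I" "kernel_dim A + card I = n" "inj_on f I" "inj_on g I"
    "f ` I \<subseteq> {..<n}" "g ` I \<subseteq> {..<n}" "\<forall>i\<in>I. A $$ (g i, f i) \<noteq> 0"
    by (rule nonzero_transversal_of_rank_size[OF A]) metis
  have inj: "inj_on ((!) vs) {..<n}" using vs(1) by (simp add: inj_on_nth n_def)
  define a b where "a i = vs ! f i" and "b i = vs ! g i" for i
  have ab: "inj_on a I" "inj_on b I"
    using comp_inj_on[OF I(3) inj_on_subset[OF inj I(5)]]
      comp_inj_on[OF I(4) inj_on_subset[OF inj I(6)]]
    by (simp_all add: a_def[abs_def] b_def[abs_def] comp_def)
  have adj: "a i \<rightarrow> b i" if "i \<in> I" for i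
  proof -
    have "g i < n" "f i < n" using that I(5,6) by auto
    then have "b i \<rightarrow> a i"
      using bspec[OF I(7) that]
      by (simp add: a_def b_def A_def adjacency_matrix_def n_def split: if_splits)
    then show ?thesis by (rule arcs_ends_symmetric[OF sym_arcs])
  qed
  have le: "card J \<le> matching_number G"
    if "J \<subseteq> I" "a ` J \<subseteq> X \<or> a ` J \<inter> X = {}" for J
    using that ab adj by (intro card_le_matching_number[of X a J b, OF X])
      (auto intro: inj_on_subset)
  define J where "J = {i \<in> I. a i \<in> X}"
  have "card J \<le> matching_number G" "card (I - J) \<le> matching_number G"
    by (intro le; auto simp: J_def)+
  moreover have "card I = card J + card (I - J)"
    using I(1) by (simp add: J_def card_Diff_subset card_mono)
  ultimately show ?thesis
    using I(2) distinct_card[OF vs(1)] vs(2) by (simp add: nullity_def A_def n_def)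
qed

theorem theorem4p2:
  fixes G :: "('a, 'b) pre_digraph" and vs :: "'a list"
  assumes "graph G"
    and "bipartite G"
    and "C4k_free G"
    and "distinct vs" and "set vs = verts G"
  shows "int (nullity G vs) = int (card (verts G)) - 2 * int (matching_number G)"
proof -
  interpret graph G by fact
  obtain M where "is_matching G M" "card M = matching_number G"
    using matching_number(1) by blast
  then show ?thesis
    using nullity_le[OF assms(2,3) _ assms(4,5), of M] le_nullity[OF assms(2,4,5)] by linarith
qed

end
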